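(* Let $X=(X_t)_{t\ge 0}$ and $Y=(Y_t)_{t\ge 0}$ be stochastic processes with values in $E=\{e_1,\dots,e_n\}$ and $F=\{f_1,\dots,f_m\}$ respectively, such that each state $e_i$ is visited at least once by $X$ with probability one and each state $f_j$ is visited at least once by $Y$ with probability one. Let $Z_t=Y_t\otimes X_t$. Assume that the factorization property holds: there is a matrix $G\in\mathbb{R}^{m\times n}$ such that $E[Z_t|\mathcal{F}_{t-1}]=\Delta(G)E[X_t|\mathcal{F}_{t-1}]$ for all $t\ge 0$. Then the following two statements are equivalent. (i) $Z$ is $\mathbb{F}$-Markov with a transition matrix of the form $Q=\bar{Q}(\mathbf{1}_m^\top\otimes I_n)$ for some $\bar Q\in\mathbb{R}^{nm\times n}$, i.e. $E[Z_{t+1}|\mathcal{F}_t]=QZ_t=\bar{Q}X_t$ for all $t\ge 0$. (ii) $X$ is $\mathbb{F}$-Markov with some transition matrix $A\in\mathbb{R}^{n\times n}$, i.e. $E[X_{t+1}|\mathcal{F}_t]=AX_t$ for all $t\ge 0$. Furthermore, in each of these situations, $\bar{Q}=\Delta(G)A$.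
   Context: All random variables live on a probability space $(\Omega,\mathcal{F},P)$; equalities of conditional expectations hold almost surely. $e_1,\dots,e_n$ are the standard basis vectors of $\mathbb{R}^n$ and $f_1,\dots,f_m$ those of $\mathbb{R}^m$. $\otimes$ is the Kronecker product, $I_n$ the $n\times n$ identity matrix, $\mathbf{1}_m$ the column vector of $m$ ones; thus $X_t=(\mathbf{1}_m^\top\otimes I_n)Z_t$. For $t\ge0$, $\mathcal{F}_t=\sigma\{X_0,\dots,X_t,Y_0,\dots,Y_t\}$, $\mathcal{F}_{-1}$ is trivial, and $\mathbb{F}=\{\mathcal{F}_t\}$. Transition matrices follow the convention that entry $(i,j)$ is the probability of moving from state $j$ to state $i$ (columns sum to one). For $M\in\mathbb{R}^{m\times n}$ with rows $M_{1\cdot},\dots,M_{m\cdot}$, $\Delta(M)\in\mathbb{R}^{nm\times n}$ is obtained by stacking the $n\times n$ diagonal matrices $\mathrm{diag}(M_{1\cdot}),\dots,\mathrm{diag}(M_{m\cdot})$ one underneath the other. *)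

theory Defs
  imports "HOL-Probability.Probability"
begin

text \<open>Vectors of length $nm$ are indexed by pairs \<open>(j, i)\<close>, where \<open>j\<close> is the number of the block and
  \<open>i\<close> the position inside the block. Matrices have type \<open>real^'col^'row\<close>.\<close>

definition kron_vec :: "real^'m \<Rightarrow> real^'n \<Rightarrow> real^('m \<times> 'n)" (infixl \<open>\<otimes>\<^sub>v\<close> 75) where
  "y \<otimes>\<^sub>v x = (\<chi> p. y $ fst p * x $ snd p)"

text \<open>The Kronecker product $v^\top \otimes B$ of a row vector with a matrix; the one-point row index
  of $v^\top$ is dropped from the row index of the product.\<close>

definition kron_row :: "real^'m \<Rightarrow> real^'n^'k \<Rightarrow> real^('m \<times> 'n)^'k" where
  "kron_row v B = (\<chi> k p. v $ fst p * B $ k $ snd p)"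

abbreviation block_sum :: "real^('m :: finite \<times> 'n :: finite)^'n" where
  "block_sum \<equiv> kron_row 1 (mat 1)"

lemma block_sum_kron_vec:
  fixes x :: "real^('n :: finite)" and j :: "'m :: finite"
  shows "(block_sum :: real^('m \<times> 'n)^'n) *v (axis j 1 \<otimes>\<^sub>v x) = x"
proof -
  have "(\<Sum>p\<in>UNIV. kron_row (1 :: real^'m) (mat 1 :: real^'n^'n) $ i $ p * (axis j 1 \<otimes>\<^sub>v x) $ p) = x $ i" for i
  proof -
    have "(\<Sum>p\<in>UNIV. kron_row (1 :: real^'m) (mat 1 :: real^'n^'n) $ i $ p * (axis j 1 \<otimes>\<^sub>v x) $ p)
        = (\<Sum>p\<in>UNIV. if p = (j, i) then x $ i else 0)"
      by (rule sum.cong) (auto simp: kron_row_def kron_vec_def mat_def axis_def)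
    then show ?thesis by simp
  qed
  then show ?thesis
    by (simp add: vec_eq_iff matrix_vector_mult_def)
qed

text \<open>The diagonal matrices $\mathrm{diag}(M_{j\cdot})$ stacked one underneath the other.\<close>

definition diag :: "real^'n \<Rightarrow> real^'n^'n" where
  "diag v = (\<chi> i k. if i = k then v $ i else 0)"

definition Delta :: "real^'n^'m \<Rightarrow> real^'n^('m \<times> 'n)" where
  "Delta G = (\<chi> p. diag (row (fst p) G) $ snd p)"

text \<open>Times are integers so that the trivial \<open>\<sigma>\<close>-algebra at time \<open>-1\<close> is included.\<close>

definition joint_filtration ::
  "'w measure \<Rightarrow> (nat \<Rightarrow> 'w \<Rightarrow> real^'n) \<Rightarrow> (nat \<Rightarrow> 'w \<Rightarrow> real^'m) \<Rightarrow> int \<Rightarrow> 'w measure" where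
  "joint_filtration M X Y t = sigma (space M)
     ({X s -` B \<inter> space M | s B. int s \<le> t \<and> B \<in> sets borel} \<union>
      {Y s -` B \<inter> space M | s B. int s \<le> t \<and> B \<in> sets borel})"

definition vec_cond_exp :: "'w measure \<Rightarrow> 'w measure \<Rightarrow> ('w \<Rightarrow> real^'k) \<Rightarrow> 'w \<Rightarrow> real^'k" where
  "vec_cond_exp M F W = (\<lambda>\<omega>. \<chi> k. real_cond_exp M F (\<lambda>\<omega>'. W \<omega>' $ k) \<omega>)"

text \<open>Entry \<open>Q $ i $ j\<close> is the probability of moving from state \<open>j\<close> to state \<open>i\<close>.\<close>

definition transition_matrix :: "real^'k^'k \<Rightarrow> bool" where
  "transition_matrix Q \<longleftrightarrow> (\<forall>i j. 0 \<le> Q $ i $ j) \<and> (\<forall>j. (\<Sum>i\<in>UNIV. Q $ i $ j) = 1)"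

text \<open>The states of \<open>W\<close> are the standard basis vectors.\<close>

definition markov_wrt ::
  "'w measure \<Rightarrow> (int \<Rightarrow> 'w measure) \<Rightarrow> (nat \<Rightarrow> 'w \<Rightarrow> real^'k) \<Rightarrow> real^'k^'k \<Rightarrow> bool" where
  "markov_wrt M F W Q \<longleftrightarrow> transition_matrix Q \<and>
     (\<forall>t. AE \<omega> in M. vec_cond_exp M (F (int t)) (W (Suc t)) \<omega> = Q *v W t \<omega>)"

end

theory Submission
  imports Defs
begin

text \<open>
  Since $X = (\mathbf{1}_m^\top \otimes I_n) Z$, multiplying the Markov equation of \<open>Z\<close> by
  $\mathbf{1}_m^\top \otimes I_n$ gives (ii) with $A = (\mathbf{1}_m^\top \otimes I_n) \bar Q$, and
  multiplying that of \<open>X\<close> by $\Delta(G)$ gives (i) with $\bar Q = \Delta(G) A$ by factorization.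
  For $\Delta(G) A (\mathbf{1}_m^\top \otimes I_n)$ to be a transition matrix, \<open>G\<close> has to be column
  stochastic: taking expectations in the factorization property yields
  $P(Y_t = f_j, X_t = e_i) = G_{ji} P(X_t = e_i)$, and for every \<open>i\<close> some \<open>t\<close> has $P(X_t = e_i) > 0$
  because $e_i$ is visited. The same fact shows that $\bar Q X_t = \Delta(G) A X_t$ for all \<open>t\<close>
  determines $\bar Q$.
\<close>

section \<open>Entries of the block matrices and stochasticity of their products\<close>

lemma kron_vec_nth [simp]: "(y \<otimes>\<^sub>v x) $ (j, i) = y $ j * x $ i"
  by (simp add: kron_vec_def)

lemma Delta_nth: "Delta G $ (j, i) $ k = (if i = k then G $ j $ i else 0)"
  by (simp add: Delta_def diag_def row_def)

lemma Delta_mult_vec_nth [simp]: "(Delta G *v x) $ (j, i) = G $ j $ i * x $ i"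
  by (simp add: matrix_vector_mult_def Delta_nth if_distrib[where f="\<lambda>u. u * _"] cong: if_cong)

lemma Delta_mult_nth [simp]: "(Delta G ** A) $ (j, i) $ k = G $ j $ i * A $ i $ k"
  by (simp add: matrix_matrix_mult_def Delta_nth if_distrib[where f="\<lambda>u. u * _"] cong: if_cong)

lemma block_sum_nth: "(block_sum :: real^('m::finite \<times> 'n::finite)^'n) $ i $ p = (if i = snd p then 1 else 0)"
  by (simp add: kron_row_def mat_def)

lemma mult_block_sum_nth [simp]:
  fixes B :: "real^'n::finite^'k::finite"
  shows "(B ** (block_sum :: real^('m::finite \<times> 'n)^'n)) $ k $ p = B $ k $ snd p"
  by (simp add: matrix_matrix_mult_def block_sum_nth if_distrib[where f="\<lambda>u. _ * u"] cong: if_cong)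

lemma block_sum_mult_nth [simp]:
  fixes B :: "real^'k::finite^('m::finite \<times> 'n::finite)"
  shows "((block_sum :: real^('m \<times> 'n)^'n) ** B) $ i $ k = (\<Sum>j\<in>UNIV. B $ (j, i) $ k)"
  by (simp add: matrix_matrix_mult_def block_sum_nth if_distrib[where f="\<lambda>u. u * _"]
      UNIV_Times_UNIV[symmetric] sum.cartesian_product' del: UNIV_Times_UNIV cong: if_cong)

text \<open>The block index \<open>j\<close> is placed innermost: for a fixed position
  \<open>i\<close>, summing over the blocks is what produces column sums of \<open>G\<close> and
  coordinates of \<open>block_sum ** Q\<close>.\<close>

lemma sum_UNIV_prod:
  "(\<Sum>p\<in>(UNIV :: ('m::finite \<times> 'n::finite) set). h p) = (\<Sum>i\<in>UNIV. \<Sum>j\<in>UNIV. h (j, i))"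
  by (subst sum.swap)
    (simp add: UNIV_Times_UNIV[symmetric] sum.cartesian_product' del: UNIV_Times_UNIV)

text \<open>Column \<open>i\<close> of \<open>Q\<close> recurs as column \<open>(j, i)\<close> of
  \<open>Q ** block_sum\<close> for every block \<open>j\<close>, so the columns of \<open>Q\<close>
  are probability vectors, and adding up the blocks of such a vector gives a probability vector
  again.\<close>

lemma transition_matrix_block_sum_mult:
  fixes Q :: "real^'n::finite^('m::finite \<times> 'n)"
  assumes "transition_matrix (Q ** (block_sum :: real^('m \<times> 'n)^'n))"
  shows "transition_matrix ((block_sum :: real^('m \<times> 'n)^'n) ** Q)"
proof -
  let ?T = "Q ** (block_sum :: real^('m \<times> 'n)^'n)"
  \<comment> \<open>The block index does not affect the entry, so \<open>undefined\<close> serves as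
    an arbitrary one.\<close>
  have "0 \<le> ?T $ p $ (undefined, i)" "(\<Sum>p\<in>UNIV. ?T $ p $ (undefined, i)) = 1" for p i
    using assms unfolding transition_matrix_def by blast+
  then have "0 \<le> Q $ p $ i" "(\<Sum>p\<in>UNIV. Q $ p $ i) = 1" for p i
    by simp_all
  then show ?thesis
    by (auto simp: transition_matrix_def sum_UNIV_prod intro!: sum_nonneg)
qed

text \<open>In each column, summing over the blocks first replaces \<open>G\<close> by its column
  sums, all equal to 1, and leaves a column sum of \<open>A\<close>.\<close>

lemma transition_matrix_Delta_mult_block_sum:
  fixes G :: "real^'n::finite^'m::finite"
  assumes "\<And>j i. 0 \<le> G $ j $ i" "\<And>i. (\<Sum>j\<in>UNIV. G $ j $ i) = 1" and A: "transition_matrix A"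
  shows "transition_matrix (Delta G ** A ** (block_sum :: real^('m \<times> 'n)^'n))"
  using assms
  by (auto simp: transition_matrix_def sum_UNIV_prod sum_distrib_right[symmetric])

section \<open>Filtration, conditional expectation of vectors, and states that are visited\<close>

lemma subalgebra_joint_filtration:
  fixes X :: "nat \<Rightarrow> 'w \<Rightarrow> real^'n" and Y :: "nat \<Rightarrow> 'w \<Rightarrow> real^'m"
  assumes "\<And>t. X t \<in> borel_measurable M" "\<And>t. Y t \<in> borel_measurable M"
  shows "subalgebra M (joint_filtration M X Y t)"
proof -
  let ?S = "{X s -` B \<inter> space M | s B. int s \<le> t \<and> B \<in> sets borel} \<union>
      {Y s -` B \<inter> space M | s B. int s \<le> t \<and> B \<in> sets borel}"
  have "?S \<subseteq> sets M"
    using assms by (auto intro: measurable_sets)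
  moreover from this have "?S \<subseteq> Pow (space M)"
    using sets.space_closed by blast
  ultimately show ?thesis
    by (simp add: subalgebra_def joint_filtration_def space_measure_of sets_measure_of
        sets.sigma_sets_subset)
qed

text \<open>Each coordinate is linearity of \<open>real_cond_exp\<close>; as there are finitely many
  coordinates, the exceptional null sets can be united.\<close>

lemma (in sigma_finite_subalgebra) vec_cond_exp_matrix_mult:
  fixes W :: "'a \<Rightarrow> real^'k" and B :: "real^'k^'l"
  assumes "\<And>k. integrable M (\<lambda>\<omega>. W \<omega> $ k)"
  shows "AE \<omega> in M. vec_cond_exp M F (\<lambda>\<omega>. B *v W \<omega>) \<omega> = B *v vec_cond_exp M F W \<omega>"
proof -
  have "AE \<omega> in M. real_cond_exp M F (\<lambda>\<omega>. (B *v W \<omega>) $ l) \<omega>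
      = (\<Sum>k\<in>UNIV. B $ l $ k * real_cond_exp M F (\<lambda>\<omega>. W \<omega> $ k) \<omega>)" for l
  proof -
    have "AE \<omega> in M. real_cond_exp M F (\<lambda>\<omega>. \<Sum>k\<in>UNIV. B $ l $ k * W \<omega> $ k) \<omega>
        = (\<Sum>k\<in>UNIV. real_cond_exp M F (\<lambda>\<omega>. B $ l $ k * W \<omega> $ k) \<omega>)"
      using assms by (intro real_cond_exp_sum) auto
    moreover have "AE \<omega> in M. \<forall>k. real_cond_exp M F (\<lambda>\<omega>. B $ l $ k * W \<omega> $ k) \<omega>
        = B $ l $ k * real_cond_exp M F (\<lambda>\<omega>. W \<omega> $ k) \<omega>"
      using assms by (simp add: AE_all_countable real_cond_exp_cmult)
    ultimately show ?thesis
      by eventually_elim (simp add: matrix_vector_mult_def)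
  qed
  then have "AE \<omega> in M. \<forall>l. real_cond_exp M F (\<lambda>\<omega>. (B *v W \<omega>) $ l) \<omega>
      = (\<Sum>k\<in>UNIV. B $ l $ k * real_cond_exp M F (\<lambda>\<omega>. W \<omega> $ k) \<omega>)"
    by (simp add: AE_all_countable)
  then show ?thesis
    by eventually_elim (simp add: vec_cond_exp_def vec_eq_iff matrix_vector_mult_def)
qed

lemma borel_measurable_vec_nth [measurable (raw)]:
  fixes V :: "'a \<Rightarrow> real^'k"
  assumes "V \<in> borel_measurable M"
  shows "(\<lambda>\<omega>. V \<omega> $ k) \<in> borel_measurable M"
  using borel_measurable_inner[OF assms borel_measurable_const[of "axis k 1"]]
  by (simp add: inner_axis)

lemma borel_measurable_vecI:
  fixes V :: "'a \<Rightarrow> real^'k"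
  assumes "\<And>k. (\<lambda>\<omega>. V \<omega> $ k) \<in> borel_measurable M"
  shows "V \<in> borel_measurable M"
  using assms by (subst borel_measurable_euclidean_space) (auto simp: Basis_vec_def inner_axis)

text \<open>This serves to replace \<open>X t\<close> by \<open>block_sum *v Z t\<close>, an
  identity available only on \<open>space M\<close>, where \<open>Y t\<close> is a basis
  vector.\<close>

lemma (in sigma_finite_subalgebra) vec_cond_exp_cong:
  assumes "\<And>\<omega>. \<omega> \<in> space M \<Longrightarrow> V \<omega> = W \<omega>"
    and "V \<in> borel_measurable M" "W \<in> borel_measurable M"
  shows "AE \<omega> in M. vec_cond_exp M F V \<omega> = vec_cond_exp M F W \<omega>"
proof -
  have "AE \<omega> in M. real_cond_exp M F (\<lambda>\<omega>. V \<omega> $ k) \<omega> = real_cond_exp M F (\<lambda>\<omega>. W \<omega> $ k) \<omega>" for k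
    using assms by (intro real_cond_exp_cong borel_measurable_vec_nth) auto
  then have "AE \<omega> in M. \<forall>k. real_cond_exp M F (\<lambda>\<omega>. V \<omega> $ k) \<omega> = real_cond_exp M F (\<lambda>\<omega>. W \<omega> $ k) \<omega>"
    by (simp add: AE_all_countable)
  then show ?thesis
    by eventually_elim (simp add: vec_cond_exp_def vec_eq_iff)
qed

text \<open>Otherwise every \<open>P t\<close> would fail almost surely, and by countability all of
  them at once. The negated \<open>AE\<close> expresses positive probability without asking that the
  events be measurable.\<close>

lemma (in prob_space) ex_not_AE_not:
  assumes "AE \<omega> in M. \<exists>t::nat. P t \<omega>"
  shows "\<exists>t. \<not> (AE \<omega> in M. \<not> P t \<omega>)"
proof (rule ccontr)
  assume "\<not> ?thesis"
  then have "AE \<omega> in M. \<forall>t. \<not> P t \<omega>"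
    by (simp add: AE_all_countable)
  with assms have "AE \<omega> in M. False"
    by eventually_elim auto
  then show False by simp
qed

text \<open>Where \<open>X t\<close> equals \<open>axis i 1\<close>, the equation compares the
  columns \<open>i\<close> of \<open>B\<close> and \<open>C\<close>; for a suitable \<open>t\<close>
  this event is not null.\<close>

lemma (in prob_space) matrix_eq_if_AE_mult_eq:
  fixes X :: "nat \<Rightarrow> 'a \<Rightarrow> real^'n" and B C :: "real^'n^'k"
  assumes visit: "\<And>i. AE \<omega> in M. \<exists>t. X t \<omega> = axis i 1"
    and eq: "\<And>t. AE \<omega> in M. B *v X t \<omega> = C *v X t \<omega>"
  shows "B = C"
proof -
  have "column i B = column i C" for i
  proof -
    obtain t where t: "\<not> (AE \<omega> in M. X t \<omega> \<noteq> axis i 1)"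
      using ex_not_AE_not[OF visit] by blast
    show ?thesis
    proof (rule ccontr)
      assume neq: "column i B \<noteq> column i C"
      have "AE \<omega> in M. X t \<omega> \<noteq> axis i 1"
        using eq[of t]
      proof eventually_elim
        case (elim \<omega>)
        with neq show ?case
          by (auto simp: matrix_vector_mult_basis)
      qed
      with t show False by simp
    qed
  qed
  then show ?thesis
    by (simp add: vec_eq_iff column_def)
qed

section \<open>The equivalence and the formula for \<open>Qbar\<close>\<close>

theorem proposition3p2:
  fixes M :: "'w measure"
    and X :: "nat \<Rightarrow> 'w \<Rightarrow> real^'n"
    and Y :: "nat \<Rightarrow> 'w \<Rightarrow> real^'m"
    and Z :: "nat \<Rightarrow> 'w \<Rightarrow> real^('m \<times> 'n)"
    and F :: "int \<Rightarrow> 'w measure"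
    and G :: "real^'n^'m"
  assumes "prob_space M"
    and "\<And>t. X t \<in> borel_measurable M"
    and "\<And>t. Y t \<in> borel_measurable M"
    and "\<And>t \<omega>. \<omega> \<in> space M \<Longrightarrow> X t \<omega> \<in> range (\<lambda>i. axis i 1)"
    and "\<And>t \<omega>. \<omega> \<in> space M \<Longrightarrow> Y t \<omega> \<in> range (\<lambda>j. axis j 1)"
    and "\<And>i. AE \<omega> in M. \<exists>t. X t \<omega> = axis i 1"
    and "\<And>j. AE \<omega> in M. \<exists>t. Y t \<omega> = axis j 1"
    and "\<And>t \<omega>. Z t \<omega> = Y t \<omega> \<otimes>\<^sub>v X t \<omega>"
    and "F = joint_filtration M X Y"
    and factorization:
      "\<And>t. AE \<omega> in M. vec_cond_exp M (F (int t - 1)) (Z t) \<omega> =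
                     Delta G *v vec_cond_exp M (F (int t - 1)) (X t) \<omega>"
  shows "((\<exists>Qbar :: real^'n^('m \<times> 'n). markov_wrt M F Z (Qbar ** block_sum))
            \<longleftrightarrow> (\<exists>A :: real^'n^'n. markov_wrt M F X A)) \<and>
         (\<forall>(Qbar :: real^'n^('m \<times> 'n)) (A :: real^'n^'n).
            markov_wrt M F Z (Qbar ** block_sum) \<longrightarrow> markov_wrt M F X A \<longrightarrow> Qbar = Delta G ** A)"
proof -
  interpret prob_space M by fact
  have X[measurable]: "X t \<in> borel_measurable M" and Y[measurable]: "Y t \<in> borel_measurable M" for t
    by fact+
  have X_nth: "X t \<omega> $ i \<in> {0, 1}" and Y_nth: "Y t \<omega> $ j \<in> {0, 1}" if "\<omega> \<in> space M" for t \<omega> i j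
    using assms(4,5)[OF that, of t] by (auto simp: axis_def)
  have Y_sum: "(\<Sum>j\<in>UNIV. Y t \<omega> $ j) = 1" if "\<omega> \<in> space M" for t \<omega>
    using assms(5)[OF that, of t] by (auto simp: axis_def)
  have X_Z: "block_sum *v Z t \<omega> = X t \<omega>" if "\<omega> \<in> space M" for t \<omega>
    using assms(5)[OF that, of t] by (auto simp: assms(8) block_sum_kron_vec)
  have Z_nth: "Z t \<omega> $ (j, i) = Y t \<omega> $ j * X t \<omega> $ i" for t \<omega> i j
    by (simp add: assms(8))
  have Z[measurable]: "Z t \<in> borel_measurable M" for t
    by (rule borel_measurable_vecI) (simp add: assms(8) kron_vec_def)
  have int_X: "integrable M (\<lambda>\<omega>. X t \<omega> $ i)" for t i
  proof (rule integrable_const_bound[where B=1])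
    have "norm (X t \<omega> $ i) \<le> 1" if "\<omega> \<in> space M" for \<omega>
      using X_nth[OF that, of t i] by auto
    then show "AE \<omega> in M. norm (X t \<omega> $ i) \<le> 1" by (rule AE_I2)
  qed simp
  have int_Z: "integrable M (\<lambda>\<omega>. Z t \<omega> $ p)" for t p
  proof (rule integrable_const_bound[where B=1])
    obtain j i where p: "p = (j, i)" by (cases p)
    have "norm (Z t \<omega> $ p) \<le> 1" if "\<omega> \<in> space M" for \<omega>
      using X_nth[OF that, of t i] Y_nth[OF that, of t j] by (auto simp: Z_nth p)
    then show "AE \<omega> in M. norm (Z t \<omega> $ p) \<le> 1" by (rule AE_I2)
  qed simp
  have sigma_finite_F: "sigma_finite_subalgebra M (F t)" for t
  proof -
    interpret finite_measure_subalgebra M "F t"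
      by unfold_locales (simp add: assms(9) subalgebra_joint_filtration)
    show ?thesis ..
  qed
  \<comment> \<open>At time \<open>Suc t\<close> the index \<open>int (Suc t) - 1\<close> is
    \<open>int t\<close>, the one that \<open>markov_wrt\<close> conditions on.\<close>
  have factor: "AE \<omega> in M. vec_cond_exp M (F (int t)) (Z (Suc t)) \<omega>
      = Delta G *v vec_cond_exp M (F (int t)) (X (Suc t)) \<omega>" for t
    using factorization[of "Suc t"] by simp

  \<comment> \<open>A nonnegative function with integral 0 vanishes almost everywhere, and
    \<open>X t\<close> differs from \<open>axis i 1\<close> wherever its coordinate \<open>i\<close>
    is 0.\<close>
  have visit: "\<exists>t. expectation (\<lambda>\<omega>. X t \<omega> $ i) > 0" for i
  proof -
    obtain t where t: "\<not> (AE \<omega> in M. X t \<omega> \<noteq> axis i 1)"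
      using ex_not_AE_not[OF assms(6)] by blast
    have "0 \<le> X t \<omega> $ i" if "\<omega> \<in> space M" for \<omega>
      using X_nth[OF that, of t i] by auto
    then have nonneg: "AE \<omega> in M. 0 \<le> X t \<omega> $ i" by (rule AE_I2)
    have "\<not> (AE \<omega> in M. X t \<omega> $ i = 0)"
    proof
      assume "AE \<omega> in M. X t \<omega> $ i = 0"
      then have "AE \<omega> in M. X t \<omega> \<noteq> axis i 1"
        by eventually_elim auto
      with t show False by simp
    qed
    then have "expectation (\<lambda>\<omega>. X t \<omega> $ i) \<noteq> 0"
      using integral_nonneg_eq_0_iff_AE[OF int_X nonneg] by simp
    with integral_nonneg_AE[OF nonneg] show ?thesis
      by (intro exI[of _ t]) simp
  qed
  \<comment> \<open>Integration removes the conditioning. The case \<open>t = 0\<close>, conditioned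
    at time -1, is covered as well; this matters for a state visited only at time 0.\<close>
  have exp_Z: "expectation (\<lambda>\<omega>. Z t \<omega> $ (j, i)) = G $ j $ i * expectation (\<lambda>\<omega>. X t \<omega> $ i)" for t j i
  proof -
    interpret sigma_finite_subalgebra M "F (int t - 1)" by (rule sigma_finite_F)
    have "expectation (\<lambda>\<omega>. Z t \<omega> $ (j, i))
        = expectation (real_cond_exp M (F (int t - 1)) (\<lambda>\<omega>. Z t \<omega> $ (j, i)))"
      by (simp add: real_cond_exp_int int_Z)
    also have "\<dots> = expectation (\<lambda>\<omega>. G $ j $ i * real_cond_exp M (F (int t - 1)) (\<lambda>\<omega>. X t \<omega> $ i) \<omega>)"
    proof (rule integral_cong_AE)
      show "AE \<omega> in M. real_cond_exp M (F (int t - 1)) (\<lambda>\<omega>. Z t \<omega> $ (j, i)) \<omega>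
          = G $ j $ i * real_cond_exp M (F (int t - 1)) (\<lambda>\<omega>. X t \<omega> $ i) \<omega>"
        using factorization[of t]
      proof eventually_elim
        case (elim \<omega>)
        from arg_cong[OF this, of "\<lambda>v. v $ (j, i)"] show ?case
          unfolding Delta_mult_vec_nth by (simp add: vec_cond_exp_def)
      qed
    qed auto
    also have "\<dots> = G $ j $ i * expectation (\<lambda>\<omega>. X t \<omega> $ i)"
      by (simp add: real_cond_exp_int int_X)
    finally show ?thesis .
  qed
  have G_nonneg: "0 \<le> G $ j $ i" for j i
  proof -
    obtain t where t: "expectation (\<lambda>\<omega>. X t \<omega> $ i) > 0" using visit by blast
    have "0 \<le> Z t \<omega> $ (j, i)" if "\<omega> \<in> space M" for \<omega>
      using X_nth[OF that, of t i] Y_nth[OF that, of t j] by (auto simp: Z_nth)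
    then have "0 \<le> expectation (\<lambda>\<omega>. Z t \<omega> $ (j, i))"
      by (intro integral_nonneg_AE AE_I2)
    with t show ?thesis
      by (simp add: exp_Z zero_le_mult_iff)
  qed
  have G_sum: "(\<Sum>j\<in>UNIV. G $ j $ i) = 1" for i
  proof -
    obtain t where t: "expectation (\<lambda>\<omega>. X t \<omega> $ i) > 0" using visit by blast
    have "(\<Sum>j\<in>UNIV. G $ j $ i) * expectation (\<lambda>\<omega>. X t \<omega> $ i)
        = (\<Sum>j\<in>UNIV. expectation (\<lambda>\<omega>. Z t \<omega> $ (j, i)))"
      by (simp add: exp_Z sum_distrib_right)
    also have "\<dots> = expectation (\<lambda>\<omega>. \<Sum>j\<in>UNIV. Z t \<omega> $ (j, i))"
      using int_Z by simp
    \<comment> \<open>The coordinates of \<open>Y t\<close> add up to 1, so the blocks of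
      \<open>Z t\<close> add up to \<open>X t\<close>.\<close>
    also have "\<dots> = expectation (\<lambda>\<omega>. X t \<omega> $ i)"
      by (rule Bochner_Integration.integral_cong)
        (simp_all add: Z_nth sum_distrib_right[symmetric] Y_sum)
    finally show ?thesis using t by simp
  qed

  have Z_to_X: "markov_wrt M F X (block_sum ** Qbar)"
    if Q: "markov_wrt M F Z (Qbar ** block_sum)" for Qbar :: "real^'n^('m \<times> 'n)"
  proof -
    have "AE \<omega> in M. vec_cond_exp M (F (int t)) (X (Suc t)) \<omega> = (block_sum ** Qbar) *v X t \<omega>" for t
    proof -
      interpret sigma_finite_subalgebra M "F (int t)" by (rule sigma_finite_F)
      have "AE \<omega> in M. vec_cond_exp M (F (int t)) (X (Suc t)) \<omega>
          = vec_cond_exp M (F (int t)) (\<lambda>\<omega>. block_sum *v Z (Suc t) \<omega>) \<omega>"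
        by (rule vec_cond_exp_cong)
          (auto simp: X_Z cong: measurable_cong)
      moreover have "AE \<omega> in M. vec_cond_exp M (F (int t)) (\<lambda>\<omega>. block_sum *v Z (Suc t) \<omega>) \<omega>
          = (block_sum :: real^('m \<times> 'n)^'n) *v vec_cond_exp M (F (int t)) (Z (Suc t)) \<omega>"
        by (rule vec_cond_exp_matrix_mult) (rule int_Z)
      moreover have "AE \<omega> in M. vec_cond_exp M (F (int t)) (Z (Suc t)) \<omega> = (Qbar ** block_sum) *v Z t \<omega>"
        using Q by (simp add: markov_wrt_def)
      \<comment> \<open>By associativity and \<open>X_Z\<close>,
        \<open>(Qbar ** block_sum) *v Z t\<close> becomes \<open>Qbar *v X t\<close>;
        \<open>AE_space\<close> supplies the membership in \<open>space M\<close> that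
        \<open>X_Z\<close> requires.\<close>
      ultimately show ?thesis
        using AE_space
        by eventually_elim (simp add: X_Z matrix_vector_mul_assoc[symmetric])
    qed
    with Q show ?thesis
      by (simp add: markov_wrt_def transition_matrix_block_sum_mult)
  qed
  \<comment> \<open>With \<open>X t\<close> instead of \<open>Z t\<close> on the right, the equation
    serves both the converse implication and the identification of \<open>Qbar\<close>.\<close>
  have cond_Z: "AE \<omega> in M. vec_cond_exp M (F (int t)) (Z (Suc t)) \<omega> = (Delta G ** A) *v X t \<omega>"
    if A: "markov_wrt M F X A" for A t
  proof -
    have "AE \<omega> in M. vec_cond_exp M (F (int t)) (X (Suc t)) \<omega> = A *v X t \<omega>"
      using A by (simp add: markov_wrt_def)
    with factor[of t] show ?thesis
      by eventually_elim (simp add: matrix_vector_mul_assoc)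
  qed
  have X_to_Z: "markov_wrt M F Z (Delta G ** A ** block_sum)" if A: "markov_wrt M F X A" for A
  proof -
    have "AE \<omega> in M. vec_cond_exp M (F (int t)) (Z (Suc t)) \<omega> = (Delta G ** A ** block_sum) *v Z t \<omega>" for t
      using cond_Z[OF A, of t] AE_space
      by eventually_elim (simp add: X_Z matrix_vector_mul_assoc[symmetric])
    \<comment> \<open>The equation alone does not make the product a transition matrix;
      \<open>G_nonneg\<close> and \<open>G_sum\<close> enter here.\<close>
    then show ?thesis
      using A by (simp add: markov_wrt_def transition_matrix_Delta_mult_block_sum G_nonneg G_sum)
  qed
  \<comment> \<open>For any admissible pair, both products applied to \<open>X t\<close> give the
    same conditional expectation of \<open>Z (Suc t)\<close>.\<close>
  have "Qbar = Delta G ** A"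
    if Q: "markov_wrt M F Z (Qbar ** block_sum)" and A: "markov_wrt M F X A" for Qbar A
  proof (rule matrix_eq_if_AE_mult_eq[of X, OF assms(6)])
    fix t
    have "AE \<omega> in M. vec_cond_exp M (F (int t)) (Z (Suc t)) \<omega> = (Qbar ** block_sum) *v Z t \<omega>"
      using Q by (simp add: markov_wrt_def)
    with cond_Z[OF A, of t] show "AE \<omega> in M. Qbar *v X t \<omega> = (Delta G ** A) *v X t \<omega>"
      using AE_space
      by eventually_elim (simp add: X_Z matrix_vector_mul_assoc[symmetric])
  qed
  then show ?thesis
    using Z_to_X X_to_Z by blast
qed

end
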